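(* Let $D=\{(b_i,d_i)\}_{i=1}^N$ and $D'=\{(b_i',d_i')\}_{i=1}^N$ be persistence diagrams indexed by the same set $\{1,\dots,N\}$ via a fixed bottleneck-distance-optimal matching between them (after padding with diagonal points). Let $K$ be a positive integer (the number of landscape layers), and let $(k,m)\in\{1,\dots,K\}\times\mathbb{R}$. Let $\varphi_r(v_{(k,m)}(D))$ and $\varphi_r(v_{(k,m)}(D'))$ denote the Shapley values of the player of rank $r$ in the game $v_{(k,m)}$ built from $D$ and from $D'$, respectively. Then for every rank $r\in\{1,\dots,N\}$, \[|\varphi_r(v_{(k,m)}(D))-\varphi_r(v_{(k,m)}(D'))|\le\left(\frac{2}{\max(r,k)}-\frac1N\right)\varepsilon\le 2\varepsilon,\] where $\varepsilon=\max_{i}\max(|b_i-b_i'|,|d_i-d_i'|)$, i.e., $\varepsilon=d_B(D,D')$.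
   Context: A persistence diagram is a finite multiset of points $(b_i,d_i)\in\mathbb{R}^2$ with $b_i\le d_i$. A matching between diagrams $D,D'$ is a bijection $\gamma: D\cup\Delta\to D'\cup\Delta$, where $\Delta=\{(x,x):x\in\mathbb{R}\}$ is the diagonal taken with infinite multiplicity, and the bottleneck distance $d_B(D,D')$ is the infimum over all matchings $\gamma$ of the largest cost $\|(b,d)-\gamma(b,d)\|_\infty$ over matched pairs. Whichever diagram has fewer off-diagonal points is padded with the matched diagonal points so that both diagrams have $N$ points; point $i$ of $D$ and point $i$ of $D'$ are the two ends of one matched pair of the fixed optimal matching. The tent function of a point $(b_i,d_i)$ is $\ell_i(m)=\min(\max(0,m-b_i),\max(0,d_i-m))$. The landscape game $v_{(k,m)}$ of a diagram with points indexed by $\{1,\dots,N\}$ assigns to a coalition $S\subset\{1,\dots,N\}$ the value $v_{(k,m)}(S)=$ the $k$-th largest value (with multiplicity) among $\{\ell_i(m):i\in S\}$ if $|S|\ge k$, and $0$ if $|S|<k$. The number of layers $K$ is chosen independently of $N$. The Shapley value of player $i$ in a game $v$ on $\{1,\dots,N\}$ is $\varphi_i(v)=\frac1N\sum_{S\subset\{1,\dots,N\}\setminus\{i\}}\binom{N-1}{|S|}^{-1}(v(S\cup\{i\})-v(S))$. The rank of a player in a given diagram at $m$ is its position when the tent values at $m$ of that diagram are sorted in decreasing order (rank $1$ is the largest). The player of rank $r$ in $D$ and the player of rank $r$ in $D'$ need not have the same index.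
   Formalization: The first inequality is stated only for k ≤ 2N, since for k > 2N and ε > 0 both Shapley values are 0 while the coefficient 2/max(r,k) − 1/N is negative; the bound 2ε and ε = d_B(D,D') are stated for all k. *)

theory Defs
  imports "HOL-Analysis.Analysis" "HOL-Library.Multiset"
begin

type_synonym point = "real \<times> real"
type_synonym diagram = "point multiset"

definition persistence_diagram :: "diagram \<Rightarrow> bool" where
  "persistence_diagram D \<longleftrightarrow> (\<forall>(b, d) \<in> set_mset D. b \<le> d)"

text \<open>
  The elements of \<open>D \<union> \<Delta>\<close> with multiplicities resolved: \<open>Inl (p, j)\<close> is the \<open>j\<close>-th copy of the
  point \<open>p\<close> of \<open>D\<close>, and \<open>Inr (x, j)\<close> is the \<open>j\<close>-th of the countably many copies of the diagonal
  point \<open>(x, x)\<close>. A point of \<open>D\<close> that happens to lie on the diagonal is an \<open>Inl\<close> element.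
\<close>

type_synonym element = "point \<times> nat + real \<times> nat"

definition augmented :: "diagram \<Rightarrow> element set" where
  "augmented D = {(p, j). j < count D p} <+> UNIV"

fun position :: "element \<Rightarrow> point" where
  "position (Inl (p, j)) = p"
| "position (Inr (x, j)) = (x, x)"

definition linf_dist :: "point \<Rightarrow> point \<Rightarrow> real" where
  "linf_dist p q = max \<bar>fst p - fst q\<bar> \<bar>snd p - snd q\<bar>"

definition matching :: "(element \<Rightarrow> element) \<Rightarrow> diagram \<Rightarrow> diagram \<Rightarrow> bool" where
  "matching \<gamma> D D' \<longleftrightarrow> bij_betw \<gamma> (augmented D) (augmented D')"

text \<open>The cost is extended real, since a matching may move diagonal points arbitrarily far.\<close>

definition matching_cost :: "(element \<Rightarrow> element) \<Rightarrow> diagram \<Rightarrow> ereal" where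
  "matching_cost \<gamma> D = (SUP x\<in>augmented D. ereal (linf_dist (position x) (position (\<gamma> x))))"

definition bottleneck_distance :: "diagram \<Rightarrow> diagram \<Rightarrow> ereal" where
  "bottleneck_distance D D' = (INF \<gamma>\<in>{\<gamma>. matching \<gamma> D D'}. matching_cost \<gamma> D)"

definition optimal_matching :: "(element \<Rightarrow> element) \<Rightarrow> diagram \<Rightarrow> diagram \<Rightarrow> bool" where
  "optimal_matching \<gamma> D D' \<longleftrightarrow>
     matching \<gamma> D D' \<and> matching_cost \<gamma> D = bottleneck_distance D D'"

text \<open>
  The pairs of a matching that get an index after padding, represented by their end in
  \<open>D \<union> \<Delta>\<close>: those with at least one end in \<open>D\<close> or \<open>D'\<close>, as opposed to two ends in \<open>\<Delta>\<close>.
\<close>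

definition indexed_pairs :: "(element \<Rightarrow> element) \<Rightarrow> diagram \<Rightarrow> element set" where
  "indexed_pairs \<gamma> D = {x \<in> augmented D. x \<in> range Inl \<or> \<gamma> x \<in> range Inl}"

text \<open>
  \<open>(b i, d i)\<close> and \<open>(b' i, d' i)\<close>, for \<open>i \<in> {1..N}\<close>, list the padded diagrams \<open>D\<close> and \<open>D'\<close> so that
  they are the two ends of the \<open>i\<close>-th matched pair of \<open>\<gamma>\<close>.
\<close>

definition indexed_by_matching ::
  "(element \<Rightarrow> element) \<Rightarrow> diagram \<Rightarrow> nat \<Rightarrow> (nat \<Rightarrow> real) \<Rightarrow> (nat \<Rightarrow> real) \<Rightarrow>
    (nat \<Rightarrow> real) \<Rightarrow> (nat \<Rightarrow> real) \<Rightarrow> bool" where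
  "indexed_by_matching \<gamma> D N b d b' d' \<longleftrightarrow>
     (\<exists>e. bij_betw e {1..N} (indexed_pairs \<gamma> D) \<and>
       (\<forall>i\<in>{1..N}. position (e i) = (b i, d i) \<and> position (\<gamma> (e i)) = (b' i, d' i)))"

definition tent :: "real \<Rightarrow> real \<Rightarrow> real \<Rightarrow> real" where
  "tent b d m = min (max 0 (m - b)) (max 0 (d - m))"

text \<open>Intended for \<open>1 \<le> k \<le> card S\<close>; the list sorted in decreasing order is indexed from 0.\<close>

definition kth_largest :: "nat \<Rightarrow> (nat \<Rightarrow> real) \<Rightarrow> nat set \<Rightarrow> real" where
  "kth_largest k f S = rev (sorted_list_of_multiset (image_mset f (mset_set S))) ! (k - 1)"

definition landscape_game ::
  "(nat \<Rightarrow> real) \<Rightarrow> (nat \<Rightarrow> real) \<Rightarrow> nat \<Rightarrow> real \<Rightarrow> nat set \<Rightarrow> real" where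
  "landscape_game b d k m S =
     (if k \<le> card S then kth_largest k (\<lambda>i. tent (b i) (d i) m) S else 0)"

definition shapley :: "nat \<Rightarrow> (nat set \<Rightarrow> real) \<Rightarrow> nat \<Rightarrow> real" where
  "shapley N v i =
     1 / real N *
       (\<Sum>S\<in>Pow ({1..N} - {i}). (v (insert i S) - v S) / real ((N - 1) choose card S))"

text \<open>
  \<open>\<rho> r\<close> is the player of rank \<open>r\<close> when the players \<open>{1..N}\<close> are sorted by decreasing tent value
  at \<open>m\<close>. If there are ties, several \<open>\<rho>\<close> satisfy this, one for each way of breaking the ties.
\<close>

definition ranking ::
  "nat \<Rightarrow> (nat \<Rightarrow> real) \<Rightarrow> (nat \<Rightarrow> real) \<Rightarrow> real \<Rightarrow> (nat \<Rightarrow> nat) \<Rightarrow> bool" where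
  "ranking N b d m \<rho> \<longleftrightarrow> bij_betw \<rho> {1..N} {1..N} \<and>
     antimono_on {1..N} (\<lambda>r. tent (b (\<rho> r)) (d (\<rho> r)) m)"

end

theory Submission
  imports Defs
begin

text \<open>
  Write \<open>a 1 \<ge> \<dots> \<ge> a N \<ge> a (N + 1) = 0\<close> for the sorted tent values. The landscape game is the
  combination, with coefficients \<open>a j - a (j + 1)\<close>, of the games ``\<open>S\<close> contains at least \<open>k\<close> of the
  \<open>j\<close> top players''. Such a game has Shapley value \<open>1 / j\<close> for each top player if \<open>k \<le> j\<close> and is
  zero otherwise, since null players can be removed, so the player of rank \<open>r\<close> gets
  \<open>\<Sum>j = max r k..N. (a j - a (j + 1)) / j\<close>. Sorting is \<open>1\<close>-Lipschitz in the maximum norm, and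
  after Abel summation the coefficients have absolute sum \<open>2 / max r k - 1 / N\<close>.

  An optimal matching might pair two diagonal points at a cost exceeding \<open>\<epsilon>\<close>. Matching the
  pairs without an index anew at zero cost, one diagonal position at a time, shows that
  \<open>\<epsilon>\<close> is the bottleneck distance.
\<close>

section \<open>The bottleneck distance and the indexed pairs\<close>

lemma ex_bij_infinite_nat:
  fixes S T :: "nat set"
  assumes "infinite S" "infinite T"
  shows "\<exists>h. bij_betw h S T"
  using bij_betw_trans[OF bij_betw_inv_into[OF bij_enumerate[OF assms(1)]] bij_enumerate[OF assms(2)]]
  by blast

text \<open>Removing a finite set leaves infinitely many copies over each \<open>x\<close>, so the
  two remaining fibres are infinite subsets of \<open>nat\<close> and are in bijection. Fixing
  \<open>fst\<close> means that diagonal copies are rematched without being moved.\<close>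

lemma ex_fibrewise_bij:
  fixes P Q :: "('a \<times> nat) set"
  assumes "finite P" "finite Q"
  shows "\<exists>h. bij_betw h (- P) (- Q) \<and> (\<forall>y. fst (h y) = fst y)"
proof -
  have inf: "infinite {j. (x, j) \<notin> R}" if "finite R" for x and R :: "('a \<times> nat) set"
  proof -
    have "finite {j. (x, j) \<in> R}"
      using finite_vimageI[OF that, of "Pair x"] by (simp add: vimage_def inj_on_def)
    then show ?thesis
      using finite_compl[of "{j. (x, j) \<in> R}"] by (simp add: Collect_neg_eq)
  qed
  have "\<forall>x. \<exists>h. bij_betw h {j. (x, j) \<notin> P} {j. (x, j) \<notin> Q}"
    using ex_bij_infinite_nat inf assms by blast
  then obtain h where h: "\<And>x. bij_betw (h x) {j. (x, j) \<notin> P} {j. (x, j) \<notin> Q}"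
    by metis
  define g where "g = (\<lambda>(x, j). (x, h x j))"
  have "inj_on g (- P)"
  proof (rule inj_onI)
    fix y z assume yz: "y \<in> - P" "z \<in> - P" "g y = g z"
    then have "fst y = fst z" "h (fst y) (snd y) = h (fst y) (snd z)"
      by (auto simp: g_def split: prod.splits)
    moreover have "inj_on (h (fst y)) {j. (fst y, j) \<notin> P}"
      using h by (simp add: bij_betw_def)
    ultimately have "snd y = snd z"
      using yz by (metis (mono_tags, lifting) ComplD inj_onD mem_Collect_eq prod.collapse)
    with \<open>fst y = fst z\<close> show "y = z"
      by (rule prod_eqI)
  qed
  moreover have "g ` (- P) = - Q"
  proof
    show "g ` (- P) \<subseteq> - Q"
      using h by (force simp: g_def dest: bij_betwE)
    show "- Q \<subseteq> g ` (- P)"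
    proof
      fix z assume "z \<in> - Q"
      then have "snd z \<in> h (fst z) ` {j. (fst z, j) \<notin> P}"
        using h[of "fst z"] by (simp add: bij_betw_def)
      then obtain j where "(fst z, j) \<notin> P" "snd z = h (fst z) j"
        by blast
      then show "z \<in> g ` (- P)"
        by (intro image_eqI[of _ _ "(fst z, j)"]) (simp_all add: g_def prod_eq_iff)
    qed
  qed
  ultimately have "bij_betw g (- P) (- Q)"
    by (simp add: bij_betw_def)
  then show ?thesis
    by (intro exI[of _ g]) (auto simp: g_def)
qed

text \<open>Outside the indexed pairs both ends are diagonal copies, and each diagonal position
  keeps all but finitely many of its copies on either side. Rematching these position by position
  costs nothing.\<close>

lemma matching_zero_off_indexed_pairs:
  assumes \<gamma>: "matching \<gamma> D D'" and fin: "finite (indexed_pairs \<gamma> D)"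
  shows "\<exists>\<gamma>'. matching \<gamma>' D D' \<and> (\<forall>x\<in>indexed_pairs \<gamma> D. \<gamma>' x = \<gamma> x) \<and>
    (\<forall>x\<in>augmented D - indexed_pairs \<gamma> D. linf_dist (position x) (position (\<gamma>' x)) = 0)"
proof -
  define P where "P = indexed_pairs \<gamma> D"
  define B where "B = Inr -` P"
  define B' where "B' = Inr -` (\<gamma> ` P)"
  have bij: "bij_betw \<gamma> (augmented D) (augmented D')"
    using \<gamma> by (simp add: matching_def)
  have PA: "P \<subseteq> augmented D"
    by (auto simp: P_def indexed_pairs_def)
  have finP: "finite P"
    using fin by (simp add: P_def)
  have "finite B" "finite B'"
    unfolding B_def B'_def using finP by (auto intro!: finite_vimageI)
  then obtain h where h: "bij_betw h (- B) (- B')" and fst_h: "\<And>y. fst (h y) = fst y"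
    using ex_fibrewise_bij by blast
  have rest: "augmented D - P = Inr ` (- B)"
    by (auto simp: B_def P_def indexed_pairs_def augmented_def)
  \<comment> \<open>A copy of a point of \<open>D'\<close> is the end of a pair that is indexed by
    definition, so only diagonal copies are left over on the side of \<open>D'\<close>.\<close>
  have "z \<in> \<gamma> ` P" if "z \<in> augmented D'" "z \<in> range Inl" for z
  proof -
    obtain y where "y \<in> augmented D" "z = \<gamma> y"
      using bij \<open>z \<in> augmented D'\<close> by (auto simp: bij_betw_def)
    then show ?thesis
      using that by (auto simp: P_def indexed_pairs_def)
  qed
  then have rest': "augmented D' - \<gamma> ` P = Inr ` (- B')"
    by (auto simp: B'_def augmented_def)
  define g :: "element \<Rightarrow> element" where "g = map_sum id h"
  have g: "bij_betw g (augmented D - P) (augmented D' - \<gamma> ` P)"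
    using h unfolding rest rest' by (force simp: bij_betw_def inj_on_def g_def image_image)
  have bijP: "bij_betw \<gamma> P (\<gamma> ` P)"
    using bij PA by (meson bij_betw_def inj_on_subset)
  define \<gamma>' where "\<gamma>' = (\<lambda>x. if x \<in> P then \<gamma> x else g x)"
  have "bij_betw \<gamma>' (P \<union> (augmented D - P)) (\<gamma> ` P \<union> (augmented D' - \<gamma> ` P))"
  proof (rule bij_betw_combine)
    show "bij_betw \<gamma>' P (\<gamma> ` P)"
      using bijP by (subst bij_betw_cong[of _ _ \<gamma>]) (auto simp: \<gamma>'_def)
    show "bij_betw \<gamma>' (augmented D - P) (augmented D' - \<gamma> ` P)"
      using g by (subst bij_betw_cong[of _ _ g]) (auto simp: \<gamma>'_def)
  qed auto
  moreover have "P \<union> (augmented D - P) = augmented D"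
    using PA by auto
  moreover have "\<gamma> ` P \<union> (augmented D' - \<gamma> ` P) = augmented D'"
    using PA bij by (auto simp: bij_betw_def)
  ultimately have "matching \<gamma>' D D'"
    by (simp add: matching_def)
  moreover have "linf_dist (position x) (position (\<gamma>' x)) = 0" if x: "x \<in> augmented D - P" for x
  proof -
    obtain u j where "x = Inr (u, j)"
      using x unfolding rest by auto
    moreover have "h (u, j) = (u, snd (h (u, j)))"
      using fst_h[of "(u, j)"] by (metis fst_conv prod.collapse)
    ultimately have "position (g x) = position x"
      by (metis g_def map_sum.simps(2) position.simps(2))
    then show ?thesis
      using x by (simp add: \<gamma>'_def linf_dist_def)
  qed
  ultimately show ?thesis
    by (intro exI[of _ \<gamma>']) (auto simp: \<gamma>'_def P_def)
qed

text \<open>The cost of the optimal \<open>\<gamma>\<close> is a supremum that includes all indexed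
  pairs, hence is at least the maximum. Conversely, the rematched \<open>\<gamma>'\<close> has the
  same cost on indexed pairs and cost 0 elsewhere, so the infimum is at most the maximum.\<close>

lemma bottleneck_distance_eq_Max:
  assumes opt: "optimal_matching \<gamma> D D'" and ind: "indexed_by_matching \<gamma> D N b d b' d'"
    and "N > 0"
  shows "ereal (MAX i\<in>{1..N}. max \<bar>b i - b' i\<bar> \<bar>d i - d' i\<bar>) = bottleneck_distance D D'"
    (is "ereal ?\<epsilon> = _")
proof (rule antisym)
  have \<gamma>: "matching \<gamma> D D'" and cost: "matching_cost \<gamma> D = bottleneck_distance D D'"
    using opt by (auto simp: optimal_matching_def)
  obtain e where e: "bij_betw e {1..N} (indexed_pairs \<gamma> D)"
    and pos: "\<And>i. i \<in> {1..N} \<Longrightarrow> position (e i) = (b i, d i) \<and> position (\<gamma> (e i)) = (b' i, d' i)"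
    using ind unfolding indexed_by_matching_def by blast
  have dist: "linf_dist (position (e i)) (position (\<gamma> (e i))) = max \<bar>b i - b' i\<bar> \<bar>d i - d' i\<bar>"
    if "i \<in> {1..N}" for i
    using pos[OF that] by (simp add: linf_dist_def)
  have le: "max \<bar>b i - b' i\<bar> \<bar>d i - d' i\<bar> \<le> ?\<epsilon>" if "i \<in> {1..N}" for i
    using that by (intro Max_ge) auto
  have "?\<epsilon> \<in> (\<lambda>i. max \<bar>b i - b' i\<bar> \<bar>d i - d' i\<bar>) ` {1..N}"
    using \<open>N > 0\<close> by (intro Max_in) auto
  then obtain i where i: "i \<in> {1..N}" "?\<epsilon> = max \<bar>b i - b' i\<bar> \<bar>d i - d' i\<bar>"
    by blast
  have "e i \<in> augmented D"
    using bij_betwE[OF e] i by (auto simp: indexed_pairs_def)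
  then have "ereal (linf_dist (position (e i)) (position (\<gamma> (e i)))) \<le> matching_cost \<gamma> D"
    unfolding matching_cost_def by (rule SUP_upper)
  then show "ereal ?\<epsilon> \<le> bottleneck_distance D D'"
    using cost dist[OF i(1)] i(2) by simp
  have "finite (indexed_pairs \<gamma> D)"
    using bij_betw_finite[OF e] by simp
  then obtain \<gamma>' where \<gamma>': "matching \<gamma>' D D'"
    and on: "\<And>x. x \<in> indexed_pairs \<gamma> D \<Longrightarrow> \<gamma>' x = \<gamma> x"
    and off: "\<And>x. x \<in> augmented D - indexed_pairs \<gamma> D \<Longrightarrow>
      linf_dist (position x) (position (\<gamma>' x)) = 0"
    using matching_zero_off_indexed_pairs[OF \<gamma>] by blast
  have "linf_dist (position x) (position (\<gamma>' x)) \<le> ?\<epsilon>" if "x \<in> augmented D" for x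
  proof (cases "x \<in> indexed_pairs \<gamma> D")
    case True
    then have "x \<in> e ` {1..N}"
      using e by (simp add: bij_betw_def)
    then obtain j where "j \<in> {1..N}" "x = e j"
      by blast
    then show ?thesis
      using on[OF True] dist[of j] le[of j] by simp
  next
    case False
    moreover have "0 \<le> ?\<epsilon>"
      unfolding i(2) by simp
    ultimately show ?thesis
      using off[of x] that by simp
  qed
  then have "matching_cost \<gamma>' D \<le> ereal ?\<epsilon>"
    unfolding matching_cost_def by (intro SUP_least) simp
  then show "bottleneck_distance D D' \<le> ereal ?\<epsilon>"
    unfolding bottleneck_distance_def using \<gamma>' by (intro INF_lower2[of \<gamma>']) simp_all
qed

section \<open>Shapley values of threshold games\<close>

text \<open>This equals s! (n - s)! / (n + 1)! for \<open>s \<le> n\<close>: the probability that,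
  in a uniformly random order of \<open>n + 1\<close> players, the predecessors of a fixed player
  form a given set of size \<open>s\<close>.\<close>

definition shapley_weight :: "nat \<Rightarrow> nat \<Rightarrow> real" where
  "shapley_weight n s = 1 / (real (Suc n) * real (n choose s))"

lemma shapley_eq_weight:
  assumes "N > 0"
  shows "shapley N v i =
    (\<Sum>S\<in>Pow ({1..N} - {i}). shapley_weight (N - 1) (card S) * (v (insert i S) - v S))"
  unfolding shapley_def shapley_weight_def using assms
  by (simp add: sum_distrib_left field_simps)

text \<open>One more player comes either after or before the fixed one, which splits the event
  behind the weight in two. In the computation both binomials become multiples of
  \<open>s + t choose s\<close>, and the numerators \<open>t + 1\<close> and \<open>s + 1\<close>
  add up to \<open>n + 2\<close>.\<close>

lemma shapley_weight_add:
  assumes "s \<le> n"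
  shows "shapley_weight (Suc n) s + shapley_weight (Suc n) (Suc s) = shapley_weight n s"
proof -
  obtain t where n: "n = s + t"
    using assms le_Suc_ex by blast
  have pos: "real (s + t choose s) > 0"
    by simp
  have "Suc t * (Suc (s + t) choose s) = Suc (s + t) * (s + t choose s)"
    using binomial_absorb_comp[of "Suc (s + t)" s] by (simp add: Suc_diff_le del: binomial_Suc_Suc)
  then have 1: "real (Suc (s + t) choose s) = real (Suc (s + t)) * real (s + t choose s) / real (Suc t)"
    by (metis (no_types) nonzero_mult_div_cancel_left of_nat_Suc of_nat_mult of_nat_neq_0)
  have "Suc s * (Suc (s + t) choose Suc s) = Suc (s + t) * (s + t choose s)"
    using Suc_times_binomial[of s "s + t"] by simp
  then have 2: "real (Suc (s + t) choose Suc s) = real (Suc (s + t)) * real (s + t choose s) / real (Suc s)"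
    by (metis (no_types) nonzero_mult_div_cancel_left of_nat_Suc of_nat_mult of_nat_neq_0)
  show ?thesis
    unfolding shapley_weight_def n 1 2 using pos
    by (simp add: divide_simps del: binomial_Suc_Suc)
qed

text \<open>The players of \<open>B\<close> are removed one at a time: coalitions with and without
  \<open>x\<close> give the same value of \<open>f\<close>, and their two weights add up to the
  weight for one player fewer.\<close>

lemma shapley_sum_null_players:
  fixes f :: "'a set \<Rightarrow> real"
  assumes "finite B" "finite A" "A \<inter> B = {}"
  shows "(\<Sum>S\<in>Pow (A \<union> B). shapley_weight (card (A \<union> B)) (card S) * f (S \<inter> A)) =
    (\<Sum>S\<in>Pow A. shapley_weight (card A) (card S) * f S)"
  using assms(1,3)
proof (induction B rule: finite_induct)
  case empty
  then show ?case
    by (auto intro!: sum.cong simp: Int_absorb2)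
next
  case (insert x B)
  let ?C = "A \<union> B"
  have x: "x \<notin> ?C" and fin: "finite ?C"
    using insert assms by auto
  have card_C: "card (insert x ?C) = Suc (card ?C)"
    using x fin by simp
  have disj: "Pow ?C \<inter> insert x ` Pow ?C = {}"
    using x by auto
  have inj: "inj_on (insert x) (Pow ?C)"
    using x by (auto simp: inj_on_def)
  have "(\<Sum>S\<in>Pow (insert x ?C). shapley_weight (Suc (card ?C)) (card S) * f (S \<inter> A)) =
    (\<Sum>S\<in>Pow ?C. shapley_weight (Suc (card ?C)) (card S) * f (S \<inter> A)) +
    (\<Sum>S\<in>Pow ?C. shapley_weight (Suc (card ?C)) (card (insert x S)) * f (insert x S \<inter> A))"
    unfolding Pow_insert using fin disj
    by (simp add: sum.union_disjoint sum.reindex[OF inj])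
  also have "\<dots> = (\<Sum>S\<in>Pow ?C. shapley_weight (card ?C) (card S) * f (S \<inter> A))"
    unfolding sum.distrib[symmetric]
  proof (rule sum.cong[OF refl])
    fix S assume S: "S \<in> Pow ?C"
    then have "card (insert x S) = Suc (card S)" "insert x S \<inter> A = S \<inter> A" "card S \<le> card ?C"
      using x fin by (auto intro: card_mono simp: card_insert_if finite_subset)
    then show "shapley_weight (Suc (card ?C)) (card S) * f (S \<inter> A) +
        shapley_weight (Suc (card ?C)) (card (insert x S)) * f (insert x S \<inter> A) =
      shapley_weight (card ?C) (card S) * f (S \<inter> A)"
      by (metis distrib_right shapley_weight_add)
  qed
  also have "\<dots> = (\<Sum>S\<in>Pow A. shapley_weight (card A) (card S) * f S)"
    using insert by auto
  finally show ?case
    using card_C by simp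
qed

text \<open>Players outside \<open>T\<close> are null. Once they are removed, a member of
  \<open>T\<close> is pivotal for \<open>card T - 1 choose (k - 1)\<close> coalitions of equal
  weight, and this binomial cancels against the one in the weight.\<close>

lemma shapley_threshold_game:
  assumes T: "T \<subseteq> {1..N}" and i: "i \<in> {1..N}" and "k > 0"
  shows "shapley N (\<lambda>S. of_bool (k \<le> card (S \<inter> T))) i =
    (if i \<in> T \<and> k \<le> card T then 1 / real (card T) else 0)"
proof (cases "i \<in> T")
  case False
  then show ?thesis
    by (simp add: shapley_def)
next
  case True
  define A where "A = T - {i}"
  define B where "B = {1..N} - T"
  have fin: "finite A" "finite B" and finT: "finite T" and disj: "A \<inter> B = {}"
    using T by (auto simp: A_def B_def intro: finite_subset)
  have AB: "{1..N} - {i} = A \<union> B"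
    using T True by (auto simp: A_def B_def)
  have card_AB: "N - 1 = card (A \<union> B)"
    unfolding AB[symmetric] using i by simp
  have N: "N > 0"
    using i by simp
  have card_T: "card T = Suc (card A)"
    using True finT by (metis A_def card.remove)
  \<comment> \<open>The marginal contribution of \<open>i\<close> is 1 exactly when
    \<open>k - 1\<close> other members of \<open>T\<close> are already present.\<close>
  define f :: "nat set \<Rightarrow> real" where "f S = of_bool (card S = k - 1)" for S
  have "shapley N (\<lambda>S. of_bool (k \<le> card (S \<inter> T))) i =
    (\<Sum>S\<in>Pow (A \<union> B). shapley_weight (card (A \<union> B)) (card S) * f (S \<inter> A))"
    unfolding shapley_eq_weight[OF N] AB card_AB
  proof (rule sum.cong[OF refl])
    fix S assume S: "S \<in> Pow (A \<union> B)"
    have "insert i S \<inter> T = insert i (S \<inter> A)" "S \<inter> T = S \<inter> A"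
      using S True by (auto simp: A_def B_def)
    moreover have "i \<notin> S \<inter> A" "finite (S \<inter> A)"
      using fin by (auto simp: A_def)
    ultimately show "shapley_weight (card (A \<union> B)) (card S) *
        (of_bool (k \<le> card (insert i S \<inter> T)) - of_bool (k \<le> card (S \<inter> T))) =
      shapley_weight (card (A \<union> B)) (card S) * f (S \<inter> A)"
      using \<open>k > 0\<close> by (auto simp: f_def)
  qed
  also have "\<dots> = (\<Sum>S\<in>Pow A. shapley_weight (card A) (card S) * f S)"
    by (rule shapley_sum_null_players[OF fin(2,1) disj])
  also have "\<dots> = (\<Sum>S\<in>{S. S \<subseteq> A \<and> card S = k - 1}. shapley_weight (card A) (k - 1))"
    by (rule sum.mono_neutral_cong_right) (use fin in \<open>auto simp: f_def\<close>)
  also have "\<dots> = real (card A choose (k - 1)) * shapley_weight (card A) (k - 1)"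
    using n_subsets[OF fin(1)] by simp
  \<comment> \<open>For \<open>k > card T\<close> the binomial is 0, so the product
    vanishes.\<close>
  also have "\<dots> = (if k \<le> card T then 1 / real (card T) else 0)"
    using \<open>k > 0\<close> card_T by (auto simp: shapley_weight_def binomial_eq_0)
  finally show ?thesis
    using True by simp
qed

lemma shapley_cong:
  assumes "\<And>S. S \<subseteq> {1..N} \<Longrightarrow> v S = w S" "i \<in> {1..N}"
  shows "shapley N v i = shapley N w i"
proof -
  have "v (insert i S) - v S = w (insert i S) - w S" if "S \<subseteq> {1..N} - {i}" for S
    using assms that by (metis Diff_subset insert_subset subset_trans)
  then show ?thesis
    by (auto simp: shapley_def intro!: sum.cong)
qed

lemma shapley_sum:
  "shapley N (\<lambda>S. \<Sum>j\<in>J. c j * v j S) i = (\<Sum>j\<in>J. c j * shapley N (v j) i)"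
proof -
  have "(\<Sum>j\<in>J. c j * shapley N (v j) i) =
    1 / real N * (\<Sum>j\<in>J. \<Sum>S\<in>Pow ({1..N} - {i}).
      (c j * v j (insert i S) - c j * v j S) / real ((N - 1) choose card S))"
    by (simp add: shapley_def sum_distrib_left right_diff_distrib mult_ac)
  also have "\<dots> = shapley N (\<lambda>S. \<Sum>j\<in>J. c j * v j S) i"
    unfolding shapley_def
    by (subst sum.swap) (simp only: sum_divide_distrib sum_subtractf diff_divide_distrib)
  finally show ?thesis ..
qed

section \<open>Order-statistic games as sums of threshold games\<close>

text \<open>The entries at most \<open>y\<close> form an initial segment; index \<open>k\<close>,
  counted from 0, lies in it iff its length exceeds \<open>k\<close>.\<close>

lemma sorted_nth_le_iff:
  assumes "sorted xs" "k < length xs"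
  shows "xs ! k \<le> y \<longleftrightarrow> k < length (filter (\<lambda>x. x \<le> y) xs)"
  using assms
proof (induction xs arbitrary: k)
  case (Cons x xs)
  have "filter (\<lambda>x. x \<le> y) xs = []" if "\<not> x \<le> y"
    using Cons.prems that by (auto simp: filter_empty_conv)
  moreover have "x \<le> xs ! j" if "j < length xs" for j
    using Cons.prems that by simp
  ultimately show ?case
    using Cons by (cases k) (auto intro: order_trans)
qed simp

text \<open>Let \<open>L\<close> list the ranks occurring in \<open>S\<close> in increasing order.
  The values decrease along \<open>L\<close>, so the \<open>k\<close>-th largest value belongs to
  the \<open>k\<close>-th of these ranks, which is \<open>q\<close>. Ties are harmless, since only
  sorted lists of values are compared.\<close>

lemma kth_largest_eq:
  assumes \<rho>: "bij_betw \<rho> {1..N} {1..N}" and anti: "antimono_on {1..N} (\<lambda>r. f (\<rho> r))"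
    and S: "S \<subseteq> {1..N}" and k: "0 < k" "k \<le> card S"
  shows "\<exists>q\<in>{1..N}. kth_largest k f S = f (\<rho> q) \<and>
    (\<forall>j\<in>{1..N}. q \<le> j \<longleftrightarrow> k \<le> card (S \<inter> \<rho> ` {1..j}))"
proof -
  define R where "R = {j \<in> {1..N}. \<rho> j \<in> S}"
  define L where "L = sorted_list_of_set R"
  have finR: "finite R" and RN: "R \<subseteq> {1..N}"
    by (auto simp: R_def)
  have inj: "inj_on \<rho> {1..N}" and im: "\<rho> ` {1..N} = {1..N}"
    using \<rho> by (auto simp: bij_betw_def)
  have RS: "\<rho> ` R = S"
  proof
    show "S \<subseteq> \<rho> ` R"
    proof
      fix i assume "i \<in> S"
      moreover from this obtain j where "j \<in> {1..N}" "i = \<rho> j"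
        using im S by blast
      ultimately show "i \<in> \<rho> ` R"
        unfolding R_def by blast
    qed
  qed (auto simp: R_def)
  have injR: "inj_on \<rho> R"
    using inj RN by (rule inj_on_subset)
  have len: "length L = card S"
    using RS injR finR by (auto simp: L_def card_image)
  have setL: "set L = R"
    using finR by (simp add: L_def)
  have "mset_set S = image_mset \<rho> (mset_set R)"
    using image_mset_mset_set[OF injR] RS by simp
  then have "image_mset f (mset_set S) = mset (rev (map (\<lambda>j. f (\<rho> j)) L))"
    by (simp add: L_def multiset.map_comp comp_def flip: sorted_list_of_mset_set)
  moreover have "sorted (rev (map (\<lambda>j. f (\<rho> j)) L))"
  proof -
    have "sorted_wrt (\<lambda>x y. f (\<rho> x) \<ge> f (\<rho> y)) L"
      by (rule sorted_wrt_mono_rel[of _ "(\<le>)"])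
        (use anti RN setL in \<open>auto simp: L_def monotone_on_def subset_iff\<close>)
    then show ?thesis
      by (simp add: sorted_wrt_rev sorted_wrt_map)
  qed
  ultimately have sorted: "sorted_list_of_multiset (image_mset f (mset_set S)) =
      rev (map (\<lambda>j. f (\<rho> j)) L)"
    by (metis mset_sorted_list_of_multiset properties_for_sort sorted_sorted_list_of_multiset sorted_sort_id)
  define q where "q = L ! (k - 1)"
  have kL: "k - 1 < length L"
    using k len by simp
  have "q \<in> {1..N}"
    using nth_mem[OF kL] setL RN by (auto simp: q_def)
  moreover have "kth_largest k f S = f (\<rho> q)"
    unfolding kth_largest_def sorted q_def using kL by simp
  \<comment> \<open>The members of \<open>S\<close> among the top \<open>j\<close> players
    correspond to the entries of \<open>L\<close> that are at most \<open>j\<close>.\<close>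
  moreover have "q \<le> j \<longleftrightarrow> k \<le> card (S \<inter> \<rho> ` {1..j})" if j: "j \<in> {1..N}" for j
  proof -
    have "length (filter (\<lambda>x. x \<le> j) L) = card ({x. x \<le> j} \<inter> R)"
      using setL by (subst distinct_length_filter) (auto simp: L_def Int_commute)
    moreover have "S \<inter> \<rho> ` {1..j} = \<rho> ` ({x. x \<le> j} \<inter> R)"
      using j inj by (auto simp: R_def)
    moreover have "card (\<rho> ` ({x. x \<le> j} \<inter> R)) = card ({x. x \<le> j} \<inter> R)"
      by (rule card_image) (use injR in \<open>auto intro: inj_on_subset\<close>)
    moreover have "sorted L"
      by (simp add: L_def)
    ultimately show ?thesis
      using sorted_nth_le_iff[OF _ kL] k by (simp add: q_def) linarith
  qed
  ultimately show ?thesis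
    by blast
qed

text \<open>The thresholds met by \<open>S\<close> are those with \<open>q \<le> j\<close>, so the
  sum telescopes from \<open>a q\<close> down to \<open>a (Suc N) = 0\<close>. A coalition with
  fewer than \<open>k\<close> players meets none, in agreement with the default value 0.\<close>

lemma order_game_layers:
  fixes f :: "nat \<Rightarrow> real"
  assumes \<rho>: "bij_betw \<rho> {1..N} {1..N}" and anti: "antimono_on {1..N} (\<lambda>r. f (\<rho> r))"
    and S: "S \<subseteq> {1..N}" and k: "0 < k"
    and a: "\<And>j. j \<in> {1..N} \<Longrightarrow> a j = f (\<rho> j)" "a (Suc N) = 0"
  shows "(if k \<le> card S then kth_largest k f S else 0) =
    (\<Sum>j\<in>{1..N}. (a j - a (Suc j)) * of_bool (k \<le> card (S \<inter> \<rho> ` {1..j})))"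
proof (cases "k \<le> card S")
  case True
  obtain q where q: "q \<in> {1..N}" "kth_largest k f S = f (\<rho> q)"
    and iff: "\<And>j. j \<in> {1..N} \<Longrightarrow> q \<le> j \<longleftrightarrow> k \<le> card (S \<inter> \<rho> ` {1..j})"
    using kth_largest_eq[OF \<rho> anti S k True] by blast
  have "(\<Sum>j\<in>{1..N}. (a j - a (Suc j)) * of_bool (k \<le> card (S \<inter> \<rho> ` {1..j}))) =
    (\<Sum>j\<in>{1..N}. (a j - a (Suc j)) * of_bool (q \<le> j))"
    by (intro sum.cong refl) (simp only: iff)
  also have "\<dots> = (\<Sum>j\<in>{q..N}. a j - a (Suc j))"
    by (rule sum.mono_neutral_cong_right) (use q in auto)
  also have "\<dots> = - (\<Sum>j\<in>{q..N}. a (Suc j) - a j)"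
    by (simp flip: sum_negf)
  also have "\<dots> = f (\<rho> q)"
    using q sum_Suc_diff[of q "N" a] a(1)[OF q(1)] a(2) by simp
  finally show ?thesis
    using True q by simp
next
  case False
  have "\<not> k \<le> card (S \<inter> \<rho> ` {1..j})" for j
    using False card_mono[of S "S \<inter> \<rho> ` {1..j}"] S finite_subset by fastforce
  then show ?thesis
    using False by simp
qed

text \<open>Linearity reduces this to threshold games on the top \<open>j\<close> players. There the
  conditions \<open>r \<le> j\<close> (membership) and \<open>k \<le> j\<close> (enough players)
  merge into \<open>max r k \<le> j\<close>.\<close>

lemma shapley_order_game:
  fixes f :: "nat \<Rightarrow> real"
  assumes \<rho>: "bij_betw \<rho> {1..N} {1..N}" and anti: "antimono_on {1..N} (\<lambda>r. f (\<rho> r))"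
    and k: "0 < k" and r: "r \<in> {1..N}"
    and a: "\<And>j. j \<in> {1..N} \<Longrightarrow> a j = f (\<rho> j)" "a (Suc N) = 0"
  shows "shapley N (\<lambda>S. if k \<le> card S then kth_largest k f S else 0) (\<rho> r) =
    (\<Sum>j\<in>{max r k..N}. (a j - a (Suc j)) / real j)"
proof -
  have inj: "inj_on \<rho> {1..N}" and im: "\<rho> ` {1..N} = {1..N}"
    using \<rho> by (auto simp: bij_betw_def)
  have \<rho>r: "\<rho> r \<in> {1..N}"
    using im r by blast
  have "shapley N (\<lambda>S. if k \<le> card S then kth_largest k f S else 0) (\<rho> r) =
    shapley N (\<lambda>S. \<Sum>j\<in>{1..N}. (a j - a (Suc j)) * of_bool (k \<le> card (S \<inter> \<rho> ` {1..j}))) (\<rho> r)"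
    by (rule shapley_cong[OF order_game_layers[OF \<rho> anti _ k a] \<rho>r])
  also have "\<dots> = (\<Sum>j\<in>{1..N}. (a j - a (Suc j)) *
      shapley N (\<lambda>S. of_bool (k \<le> card (S \<inter> \<rho> ` {1..j}))) (\<rho> r))"
    by (rule shapley_sum)
  also have "\<dots> = (\<Sum>j\<in>{1..N}. (a j - a (Suc j)) * (if max r k \<le> j then 1 / real j else 0))"
  proof (rule sum.cong[OF refl])
    fix j assume j: "j \<in> {1..N}"
    then have sub: "{1..j} \<subseteq> {1..N}"
      by auto
    have "\<rho> ` {1..j} \<subseteq> {1..N}"
      using image_mono[OF sub, of \<rho>] im by simp
    moreover have "card (\<rho> ` {1..j}) = j"
      using card_image[OF inj_on_subset[OF inj sub]] by simp
    moreover have "\<rho> r \<in> \<rho> ` {1..j} \<longleftrightarrow> r \<le> j"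
      using inj_on_image_mem_iff[OF inj r sub] r by auto
    ultimately show "(a j - a (Suc j)) * shapley N (\<lambda>S. of_bool (k \<le> card (S \<inter> \<rho> ` {1..j}))) (\<rho> r) =
      (a j - a (Suc j)) * (if max r k \<le> j then 1 / real j else 0)"
      using shapley_threshold_game[of "\<rho> ` {1..j}" N "\<rho> r" k] \<rho>r k by simp
  qed
  also have "\<dots> = (\<Sum>j\<in>{max r k..N}. (a j - a (Suc j)) / real j)"
    by (rule sum.mono_neutral_cong_right) (use r in auto)
  finally show ?thesis .
qed

section \<open>Stability\<close>

text \<open>By the pigeonhole principle the top \<open>j\<close> players under \<open>\<rho>\<close>
  cannot all have rank below \<open>j\<close> under \<open>\<rho>'\<close>. A player with rank
  \<open>s \<le> j\<close> in one and \<open>t \<ge> j\<close> in the other links the two values at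
  rank \<open>j\<close>.\<close>

lemma ranked_values_le:
  fixes f f' :: "nat \<Rightarrow> real"
  assumes \<rho>: "bij_betw \<rho> {1..N} {1..N}" and anti: "antimono_on {1..N} (\<lambda>r. f (\<rho> r))"
    and \<rho>': "bij_betw \<rho>' {1..N} {1..N}" and anti': "antimono_on {1..N} (\<lambda>r. f' (\<rho>' r))"
    and close: "\<And>i. i \<in> {1..N} \<Longrightarrow> f i \<le> f' i + \<epsilon>" and j: "j \<in> {1..N}"
  shows "f (\<rho> j) \<le> f' (\<rho>' j) + \<epsilon>"
proof -
  have "card (\<rho> ` {1..j}) = j"
    using \<rho> j by (subst card_image) (auto simp: bij_betw_def intro: inj_on_subset)
  moreover have "card (\<rho>' ` {1..<j}) \<le> j - 1"
    using card_image_le[of "{1..<j}" \<rho>'] by simp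
  then have "card (\<rho>' ` {1..<j}) < j"
    using j unfolding atLeastAtMost_iff by linarith
  ultimately have "\<not> \<rho> ` {1..j} \<subseteq> \<rho>' ` {1..<j}"
    using card_mono[of "\<rho>' ` {1..<j}" "\<rho> ` {1..j}"] by auto
  then obtain s where s: "s \<in> {1..j}" "\<rho> s \<notin> \<rho>' ` {1..<j}"
    by blast
  have sN: "s \<in> {1..N}" and "s \<le> j"
    using s j by auto
  then have "\<rho> s \<in> {1..N}"
    using bij_betwE[OF \<rho>] by blast
  moreover from this obtain t where t: "t \<in> {1..N}" "\<rho> s = \<rho>' t"
    using \<rho>' by (metis bij_betw_def imageE)
  moreover have "j \<le> t"
    using s t by (force simp: not_less)
  ultimately have "f (\<rho> s) \<le> f' (\<rho> s) + \<epsilon>" "f' (\<rho> s) \<le> f' (\<rho>' j)"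
    using close[of "\<rho> s"] monotone_onD[OF anti' j] by simp_all
  moreover have "f (\<rho> j) \<le> f (\<rho> s)"
    using monotone_onD[OF anti sN j \<open>s \<le> j\<close>] by simp
  ultimately show ?thesis
    by linarith
qed

text \<open>Abel summation leaves coefficient 1/M at \<open>\<delta> M\<close> and -(1/(j-1) - 1/j)
  at each later \<open>\<delta> j\<close>. The latter telescope in absolute value to 1/M - 1/N,
  which gives the total 2/M - 1/N.\<close>

lemma abel_sum_bound:
  fixes \<delta> :: "nat \<Rightarrow> real"
  assumes "0 < M" "M \<le> N" and \<delta>: "\<And>j. j \<in> {M..N} \<Longrightarrow> \<bar>\<delta> j\<bar> \<le> \<epsilon>" "\<delta> (Suc N) = 0"
  shows "\<bar>\<Sum>j\<in>{M..N}. (\<delta> j - \<delta> (Suc j)) / real j\<bar> \<le> (2 / real M - 1 / real N) * \<epsilon>"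
proof -
  \<comment> \<open>Subtracting the leading term leaves exactly the telescoping part, which descends
    by induction from \<open>M = N\<close>, where both sides are 0.\<close>
  have "0 < M \<longrightarrow> (\<forall>j\<in>{M..N}. \<bar>\<delta> j\<bar> \<le> \<epsilon>) \<longrightarrow>
    \<bar>(\<Sum>j\<in>{M..N}. (\<delta> j - \<delta> (Suc j)) / real j) - \<delta> M / real M\<bar> \<le> (1 / real M - 1 / real N) * \<epsilon>"
    using \<open>M \<le> N\<close>
  proof (induction M rule: inc_induct)
    case base
    then show ?case
      using \<delta> by simp
  next
    case (step n)
    show ?case
    proof (intro impI)
      assume n: "0 < n" and le: "\<forall>j\<in>{n..N}. \<bar>\<delta> j\<bar> \<le> \<epsilon>"
      let ?s = "\<Sum>j\<in>{Suc n..N}. (\<delta> j - \<delta> (Suc j)) / real j"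
      let ?c = "1 / real n - 1 / real (Suc n)"
      have IH: "\<bar>?s - \<delta> (Suc n) / real (Suc n)\<bar> \<le> (1 / real (Suc n) - 1 / real N) * \<epsilon>"
        using step le by auto
      have "\<bar>?c * \<delta> (Suc n)\<bar> \<le> ?c * \<epsilon>"
        unfolding abs_mult using le step n by (intro mult_mono) (auto simp: field_simps)
      \<comment> \<open>Lowering the start to \<open>n\<close> changes the coefficient of
        \<open>\<delta> (Suc n)\<close> only by \<open>?c\<close>.\<close>
      moreover have "(\<Sum>j\<in>{n..N}. (\<delta> j - \<delta> (Suc j)) / real j) - \<delta> n / real n =
          (?s - \<delta> (Suc n) / real (Suc n)) - ?c * \<delta> (Suc n)"
        using step by (simp add: sum.atLeast_Suc_atMost diff_divide_distrib left_diff_distrib)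
      moreover have "(1 / real n - 1 / real N) * \<epsilon> = (1 / real (Suc n) - 1 / real N) * \<epsilon> + ?c * \<epsilon>"
        by (simp add: left_diff_distrib)
      ultimately show "\<bar>(\<Sum>j\<in>{n..N}. (\<delta> j - \<delta> (Suc j)) / real j) - \<delta> n / real n\<bar>
          \<le> (1 / real n - 1 / real N) * \<epsilon>"
        using IH by linarith
    qed
  qed
  then have "\<bar>(\<Sum>j\<in>{M..N}. (\<delta> j - \<delta> (Suc j)) / real j) - \<delta> M / real M\<bar>
      \<le> (1 / real M - 1 / real N) * \<epsilon>"
    using assms by blast
  moreover have "\<bar>\<delta> M / real M\<bar> \<le> \<epsilon> / real M"
    using assms by (simp add: divide_right_mono)
  moreover have "(2 / real M - 1 / real N) * \<epsilon> = (1 / real M - 1 / real N) * \<epsilon> + \<epsilon> / real M"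
    by (simp add: left_diff_distrib)
  ultimately show ?thesis
    by linarith
qed

text \<open>The explicit formula depends only on the sorted values, so it suffices to compare these
  rank by rank, even where the two players of rank \<open>r\<close> differ. For \<open>k > N\<close>
  the range of summation is empty.\<close>

lemma order_game_stability:
  fixes f f' :: "nat \<Rightarrow> real"
  assumes \<rho>: "bij_betw \<rho> {1..N} {1..N}" "antimono_on {1..N} (\<lambda>r. f (\<rho> r))"
    and \<rho>': "bij_betw \<rho>' {1..N} {1..N}" "antimono_on {1..N} (\<lambda>r. f' (\<rho>' r))"
    and close: "\<And>i. i \<in> {1..N} \<Longrightarrow> \<bar>f i - f' i\<bar> \<le> \<epsilon>"
    and k: "0 < k" and r: "r \<in> {1..N}"
  defines "\<phi> \<equiv> shapley N (\<lambda>S. if k \<le> card S then kth_largest k f S else 0) (\<rho> r)"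
    and "\<phi>' \<equiv> shapley N (\<lambda>S. if k \<le> card S then kth_largest k f' S else 0) (\<rho>' r)"
  shows "if k \<le> N then \<bar>\<phi> - \<phi>'\<bar> \<le> (2 / real (max r k) - 1 / real N) * \<epsilon> else \<phi> = 0 \<and> \<phi>' = 0"
proof -
  define a where "a j = (if j \<le> N then f (\<rho> j) else 0)" for j
  define a' where "a' j = (if j \<le> N then f' (\<rho>' j) else 0)" for j
  have \<phi>: "\<phi> = (\<Sum>j\<in>{max r k..N}. (a j - a (Suc j)) / real j)"
    unfolding \<phi>_def by (rule shapley_order_game[OF \<rho> k r]) (auto simp: a_def)
  have \<phi>': "\<phi>' = (\<Sum>j\<in>{max r k..N}. (a' j - a' (Suc j)) / real j)"
    unfolding \<phi>'_def by (rule shapley_order_game[OF \<rho>' k r]) (auto simp: a'_def)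
  show ?thesis
  proof (cases "k \<le> N")
    case True
    have "f (\<rho> j) \<le> f' (\<rho>' j) + \<epsilon>" "f' (\<rho>' j) \<le> f (\<rho> j) + \<epsilon>" if "j \<in> {1..N}" for j
      using close that
      by (intro ranked_values_le[OF \<rho> \<rho>'] ranked_values_le[OF \<rho>' \<rho>]; force simp: abs_le_iff)+
    then have "\<bar>a j - a' j\<bar> \<le> \<epsilon>" if "j \<in> {1..N}" for j
      using that by (simp add: a_def a'_def abs_le_iff) (smt (verit))
    moreover have "\<phi> - \<phi>' = (\<Sum>j\<in>{max r k..N}. ((a j - a' j) - (a (Suc j) - a' (Suc j))) / real j)"
      unfolding \<phi> \<phi>' sum_subtractf[symmetric] by (rule sum.cong[OF refl]) (simp add: diff_divide_distrib)
    ultimately have "\<bar>\<phi> - \<phi>'\<bar> \<le> (2 / real (max r k) - 1 / real N) * \<epsilon>"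
      using True k r abel_sum_bound[of "max r k" N "\<lambda>j. a j - a' j" \<epsilon>] by (simp add: a_def a'_def)
    then show ?thesis
      using True by simp
  qed (simp add: \<phi> \<phi>')
qed

text \<open>The tent value arises from \<open>m - b\<close> and \<open>d - m\<close> by truncation
  at 0 and a minimum, all 1-Lipschitz in the maximum norm.\<close>

lemma abs_tent_diff_le: "\<bar>tent b d m - tent b' d' m\<bar> \<le> max \<bar>b - b'\<bar> \<bar>d - d'\<bar>"
  by (auto simp: tent_def min_def max_def)

theorem theorem3p9:
  fixes D D' :: diagram and \<gamma> :: "element \<Rightarrow> element"
    and N K k r :: nat and b d b' d' :: "nat \<Rightarrow> real"
    and m \<epsilon> :: real and \<rho> \<rho>' :: "nat \<Rightarrow> nat"
  assumes "persistence_diagram D" and "persistence_diagram D'"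
    and "optimal_matching \<gamma> D D'"
    and "indexed_by_matching \<gamma> D N b d b' d'"
    and "K > 0" and "k \<in> {1..K}"
    and "ranking N b d m \<rho>" and "ranking N b' d' m \<rho>'"
    and "r \<in> {1..N}"
    and "\<epsilon> = (MAX i\<in>{1..N}. max \<bar>b i - b' i\<bar> \<bar>d i - d' i\<bar>)"
  shows "ereal \<epsilon> = bottleneck_distance D D' \<and>
    (k \<le> 2 * N \<longrightarrow>
      \<bar>shapley N (landscape_game b d k m) (\<rho> r) - shapley N (landscape_game b' d' k m) (\<rho>' r)\<bar>
        \<le> (2 / real (max r k) - 1 / real N) * \<epsilon>) \<and>
    (2 / real (max r k) - 1 / real N) * \<epsilon> \<le> 2 * \<epsilon> \<and>
    \<bar>shapley N (landscape_game b d k m) (\<rho> r) - shapley N (landscape_game b' d' k m) (\<rho>' r)\<bar>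
      \<le> 2 * \<epsilon>"
proof -
  let ?f = "\<lambda>i. tent (b i) (d i) m" and ?f' = "\<lambda>i. tent (b' i) (d' i) m"
  let ?\<phi> = "shapley N (landscape_game b d k m) (\<rho> r)"
  let ?\<phi>' = "shapley N (landscape_game b' d' k m) (\<rho>' r)"
  have N: "N > 0" and r: "r > 0" and k: "k > 0"
    using assms by auto
  have le: "max \<bar>b i - b' i\<bar> \<bar>d i - d' i\<bar> \<le> \<epsilon>" if "i \<in> {1..N}" for i
    unfolding assms(10) using that by (intro Max_ge) auto
  have close: "\<bar>?f i - ?f' i\<bar> \<le> \<epsilon>" if "i \<in> {1..N}" for i
    by (rule order_trans[OF abs_tent_diff_le le[OF that]])
  have \<epsilon>: "\<epsilon> \<ge> 0"
    using close[OF assms(9)] by linarith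
  have stab: "if k \<le> N then \<bar>?\<phi> - ?\<phi>'\<bar> \<le> (2 / real (max r k) - 1 / real N) * \<epsilon> else ?\<phi> = 0 \<and> ?\<phi>' = 0"
    unfolding landscape_game_def[abs_def]
    using assms(7,8) unfolding ranking_def
    by (intro order_game_stability close k assms(9)) auto
  have "2 / real (max r k) \<le> 2"
    using r by (simp add: divide_le_eq)
  moreover have "0 \<le> 1 / real N"
    by simp
  ultimately have const: "(2 / real (max r k) - 1 / real N) * \<epsilon> \<le> 2 * \<epsilon>"
    using \<epsilon> by (intro mult_right_mono) linarith+
  \<comment> \<open>For \<open>N < k \<le> 2 * N\<close> both Shapley values are 0 and the constant
    is still nonnegative. Beyond \<open>2 * N\<close> it is negative, so the sharp bound fails
    whenever \<open>\<epsilon> > 0\<close>, while the bound by \<open>2 * \<epsilon>\<close>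
    survives.\<close>
  have "\<bar>?\<phi> - ?\<phi>'\<bar> \<le> (2 / real (max r k) - 1 / real N) * \<epsilon>" if "k \<le> 2 * N"
  proof (cases "k \<le> N")
    case False
    have "max r k \<le> 2 * N"
      using that assms(9) by simp
    then have "real (max r k) \<le> 2 * real N"
      by linarith
    then have "0 \<le> 2 / real (max r k) - 1 / real N"
      using N r by (simp add: field_simps)
    then show ?thesis
      using stab False \<epsilon> by simp
  qed (use stab in simp)
  moreover have "\<bar>?\<phi> - ?\<phi>'\<bar> \<le> 2 * \<epsilon>"
    using stab const \<epsilon> by (cases "k \<le> N") auto
  moreover have "ereal \<epsilon> = bottleneck_distance D D'"
    unfolding assms(10) by (rule bottleneck_distance_eq_Max[OF assms(3,4) N])
  ultimately show ?thesis
    using const by blast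
qed

end
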